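(* Let $n$ and $i$ be positive integers and let $A,B$ be two distinct dominating sets of the path $P_n$, both of cardinality $i$. Then $\partial(A,B)=2$ if and only if $|A\cap B|=i-1$, where $\partial(A,B)$ is the distance between the vertices $A$ and $B$ in the graph $D_n(P_n)$.
   Context: $P_n$ is the path with vertex set $\{1,2,\dots,n\}$ and edge set $\{\{1,2\},\{2,3\},\dots,\{n-1,n\}\}$. A set $S\subseteq V(G)$ is a dominating set of a graph $G$ if every vertex of $V(G)\setminus S$ is adjacent to at least one vertex of $S$. The graph $D_n(P_n)$ has as vertices all dominating sets of $P_n$, two of them being adjacent if and only if one is obtained from the other by adding or deleting a single vertex (i.e. their symmetric difference has exactly one element). The distance between two vertices of a graph is the length of a shortest path joining them. *)

theory Defs
  imports "Graph_Theory.Graph_Theory"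
begin

(* A simple graph is a pair digraph whose arc relation is symmetric and
   irreflexive (locale pair_graph): each edge {u, v} is represented by the
   two arcs (u, v) and (v, u). *)

definition path_graph :: "nat \<Rightarrow> nat pair_pre_digraph" where
  "path_graph n =
    \<lparr> pverts = {1..n},
      parcs = {(u, v). u \<in> {1..n} \<and> v \<in> {1..n} \<and> (v = u + 1 \<or> u = v + 1)} \<rparr>"

definition dominating_set :: "'a pair_pre_digraph \<Rightarrow> 'a set \<Rightarrow> bool" where
  "dominating_set G S \<longleftrightarrow>
    S \<subseteq> pverts G \<and> (\<forall>v \<in> pverts G - S. \<exists>u \<in> S. (v, u) \<in> parcs G)"

definition dominating_graph :: "'a pair_pre_digraph \<Rightarrow> 'a set pair_pre_digraph" where
  "dominating_graph G =
    \<lparr> pverts = {S. dominating_set G S},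
      parcs = {(S, T). dominating_set G S \<and> dominating_set G T \<and>
                       card ((S - T) \<union> (T - S)) = 1} \<rparr>"

(* Shortest-path distance with every arc of weight 1; it is \<infinity> if the
   vertices lie in different components. The library constant \<mu> carries its
   intended meaning only on well-formed digraphs, see graph_dist_eq. *)
definition graph_dist :: "'a pair_pre_digraph \<Rightarrow> 'a \<Rightarrow> 'a \<Rightarrow> ereal" where
  "graph_dist G u v = wf_digraph.\<mu> (with_proj G) (\<lambda>_. 1) u v"

lemma graph_dist_eq:
  assumes "pair_wf_digraph G"
  shows "graph_dist G u v =
    (INF p \<in> {p. pre_digraph.awalk (with_proj G) u p v}. ereal (real (length p)))"
proof -
  interpret wf_digraph "with_proj G"
    using assms by (simp add: wf_digraph_wp_iff)
  have "awalk_cost (\<lambda>_. 1) p = real (length p)" for p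
    by (induction p) auto
  then show ?thesis
    by (simp add: graph_dist_def \<mu>_def)
qed

lemma pair_graph_path_graph: "pair_graph (path_graph n)"
proof
  show "finite (parcs (path_graph n))"
    by (rule finite_subset[of _ "{1..n} \<times> {1..n}"]) (auto simp: path_graph_def)
  show "symmetric (with_proj (path_graph n))"
    by (auto simp: symmetric_def sym_def path_graph_def)
qed (auto simp: path_graph_def)

lemma pair_graph_dominating_graph:
  assumes "finite (pverts G)"
  shows "pair_graph (dominating_graph G)"
proof
  have fin: "finite {S. dominating_set G S}"
    by (rule finite_subset[of _ "Pow (pverts G)"]) (auto simp: dominating_set_def assms)
  then show "finite (pverts (dominating_graph G))"
    by (simp add: dominating_graph_def)
  show "finite (parcs (dominating_graph G))"
    by (rule finite_subset[OF _ finite_cartesian_product[OF fin fin]])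
       (auto simp: dominating_graph_def)
  show "symmetric (with_proj (dominating_graph G))"
    by (auto simp: symmetric_def sym_def dominating_graph_def Un_commute)
qed (auto simp: dominating_graph_def)

end

theory Submission
  imports Defs
begin

text \<open>
  Two vertices of a graph are at distance 2 exactly when they are distinct, not adjacent and have
  a common neighbour. Both directions of the theorem are a count of \<open>A \<triangle> B\<close>, which splits into two
  halves \<open>A - B\<close> and \<open>B - A\<close> of the same size because \<open>A\<close> and \<open>B\<close> have the same cardinality.

  A common neighbour \<open>C\<close> forces \<open>\<bar>A \<triangle> B\<bar> \<le> \<bar>A \<triangle> C\<bar> + \<bar>C \<triangle> B\<bar> = 2\<close>, so each half has
  at most one element, and it is not empty because \<open>A \<noteq> B\<close>. Conversely, if each half is a
  singleton, then \<open>A\<close> and \<open>B\<close> are not adjacent, and \<open>A \<union> B\<close> is a common neighbour: it is one vertex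
  larger than each of them, and it dominates because a set of vertices that contains a dominating
  set is dominating. The argument is the same in every finite graph and is given at that level.
\<close>

text \<open>
  Walk lengths are natural numbers, so the infimum that defines the distance is attained as soon
  as there is a walk at all; this replaces reasoning about extended reals by reasoning about walks.
\<close>
lemma graph_dist_eq_nat_iff:
  assumes "pair_wf_digraph G"
  shows "graph_dist G u v = ereal (real k) \<longleftrightarrow>
    (\<exists>p. pre_digraph.awalk (with_proj G) u p v \<and> length p = k) \<and>
    (\<forall>p. pre_digraph.awalk (with_proj G) u p v \<longrightarrow> k \<le> length p)"
    (is "_ \<longleftrightarrow> (\<exists>p. ?W p \<and> _) \<and> _")
proof (cases "\<exists>p. ?W p")
  case True
  then obtain p where p: "?W p" and least: "\<And>q. ?W q \<Longrightarrow> length p \<le> length q"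
    using ex_has_least_nat[of ?W _ length] by blast
  have "(INF q \<in> {q. ?W q}. ereal (real (length q))) = ereal (real (length p))"
    by (rule antisym) (auto intro: INF_lower2[of p] INF_greatest simp: p least)
  then have "graph_dist G u v = ereal (real (length p))"
    by (simp add: graph_dist_eq[OF assms])
  then show ?thesis
    using p least by (auto simp: le_antisym)
next
  case False
  then have "graph_dist G u v = \<infinity>"
    by (simp add: graph_dist_eq[OF assms] top_ereal_def)
  then show ?thesis
    using False by auto
qed

lemma graph_dist_eq_2_iff:
  assumes "pair_wf_digraph G"
  shows "graph_dist G u v = 2 \<longleftrightarrow>
    u \<noteq> v \<and> (u, v) \<notin> parcs G \<and> (\<exists>w. (u, w) \<in> parcs G \<and> (w, v) \<in> parcs G)"
proof -
  interpret pair_wf_digraph G by fact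
  have walk_0: "awalk u [] v \<longleftrightarrow> u = v \<and> u \<in> pverts G" for u v
    by (auto simp: awalk_def)
  have walk_Cons: "awalk u (e # p) v \<longleftrightarrow> e \<in> parcs G \<and> fst e = u \<and> awalk (snd e) p v"
    for u v e p
    by (auto simp: awalk_Cons_iff)
  have len_2: "(\<exists>p. awalk u p v \<and> length p = 2) \<longleftrightarrow>
      (\<exists>w. (u, w) \<in> parcs G \<and> (w, v) \<in> parcs G)"
  proof
    assume "\<exists>p. awalk u p v \<and> length p = 2"
    then show "\<exists>w. (u, w) \<in> parcs G \<and> (w, v) \<in> parcs G"
      by (auto simp: numeral_2_eq_2 length_Suc_conv walk_0 walk_Cons)
  next
    assume "\<exists>w. (u, w) \<in> parcs G \<and> (w, v) \<in> parcs G"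
    then obtain w where "(u, w) \<in> parcs G" "(w, v) \<in> parcs G" by blast
    then have "awalk u [(u, w), (w, v)] v"
      using in_arcsD2 by (auto simp: walk_0 walk_Cons)
    then show "\<exists>p. awalk u p v \<and> length p = 2" by force
  qed
  have ge_2: "(\<forall>p. awalk u p v \<longrightarrow> 2 \<le> length p) \<longleftrightarrow> u \<noteq> v \<and> (u, v) \<notin> parcs G"
    if "u \<in> pverts G"
  proof
    assume *: "\<forall>p. awalk u p v \<longrightarrow> 2 \<le> length p"
    have "\<not> awalk u [] v" "\<not> awalk u [(u, v)] v"
      using * by force+
    then show "u \<noteq> v \<and> (u, v) \<notin> parcs G"
      using that in_arcsD2 by (auto simp: walk_0 walk_Cons)
  next
    assume *: "u \<noteq> v \<and> (u, v) \<notin> parcs G"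
    show "\<forall>p. awalk u p v \<longrightarrow> 2 \<le> length p"
    proof (intro allI impI)
      fix p assume "awalk u p v"
      then show "2 \<le> length p"
        \<comment> \<open>The rule splits \<open>p\<close> into the cases of no arc, one arc and at least two arcs.\<close>
        using * by (cases p rule: remdups_adj.cases) (auto simp: walk_0 walk_Cons)
    qed
  qed
  have "graph_dist G u v = 2 \<longleftrightarrow>
      (\<exists>p. awalk u p v \<and> length p = 2) \<and> (\<forall>p. awalk u p v \<longrightarrow> 2 \<le> length p)"
    using graph_dist_eq_nat_iff[OF assms, of u v 2] by simp
  then show ?thesis
    unfolding len_2 using ge_2 in_arcsD1 by blast
qed

lemma dominating_set_superset:
  assumes "dominating_set G S" and "S \<subseteq> T" and "T \<subseteq> pverts G"
  shows "dominating_set G T"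
  using assms unfolding dominating_set_def by blast

text \<open>
  For finite sets of the same size, \<open>A - B\<close> and \<open>B - A\<close> are equinumerous, so agreement in all but
  one element can be read off from either half.
\<close>
lemma card_Int_eq_card_minus_1_iff:
  assumes "finite A" and "finite B" and "card A = card B" and "A \<noteq> B"
  shows "card (A \<inter> B) = card A - 1 \<longleftrightarrow> card (A - B) = 1"
    and "card (B - A) = card (A - B)"
    and "card (A - B) > 0"
proof -
  have A: "card A = card (A \<inter> B) + card (A - B)"
    using card_Int_Diff[OF assms(1)] .
  moreover have "card B = card (A \<inter> B) + card (B - A)"
    using card_Int_Diff[OF assms(2), of A] by (simp add: Int_commute)
  ultimately show same: "card (B - A) = card (A - B)"
    using assms(3) by simp
  then show pos: "card (A - B) > 0"
    using assms by (metis Diff_eq_empty_iff card_0_eq finite_Diff gr0I subset_antisym)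
  show "card (A \<inter> B) = card A - 1 \<longleftrightarrow> card (A - B) = 1"
    using A pos by auto
qed

theorem dominating_graph_dist_eq_2_iff:
  assumes fin: "finite (pverts G)"
    and dom: "dominating_set G A" "dominating_set G B"
    and "A \<noteq> B" and "card A = card B"
  shows "graph_dist (dominating_graph G) A B = 2 \<longleftrightarrow> card (A \<inter> B) = card A - 1"
proof -
  interpret pair_graph "dominating_graph G"
    by (rule pair_graph_dominating_graph[OF fin])
  have fin_dom: "finite S" if "dominating_set G S" for S
    using that fin by (auto simp: dominating_set_def intro: finite_subset)
  note finAB = fin_dom[OF dom(1)] fin_dom[OF dom(2)]
  note halves = card_Int_eq_card_minus_1_iff[OF finAB \<open>card A = card B\<close> \<open>A \<noteq> B\<close>]
  have sym_diff: "card ((A - B) \<union> (B - A)) = 2 * card (A - B)"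
    using finAB halves(2) by (subst card_Un_disjoint) auto
  have adj: "(S, T) \<in> parcs (dominating_graph G) \<longleftrightarrow>
      dominating_set G S \<and> dominating_set G T \<and> card ((S - T) \<union> (T - S)) = 1" for S T
    by (simp add: dominating_graph_def)
  \<comment> \<open>Adjacent sets differ in one element, but here the symmetric difference has even size.\<close>
  have nonadj: "(A, B) \<notin> parcs (dominating_graph G)"
    unfolding adj sym_diff by presburger
  have "(\<exists>C. (A, C) \<in> parcs (dominating_graph G) \<and> (C, B) \<in> parcs (dominating_graph G))
      \<longleftrightarrow> card (A - B) = 1"
  proof
    assume "\<exists>C. (A, C) \<in> parcs (dominating_graph G) \<and> (C, B) \<in> parcs (dominating_graph G)"
    then obtain C where C: "dominating_set G C" "card ((A - C) \<union> (C - A)) = 1"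
        "card ((C - B) \<union> (B - C)) = 1"
      unfolding adj by blast
    have "card ((A - B) \<union> (B - A)) \<le>
        card (((A - C) \<union> (C - A)) \<union> ((C - B) \<union> (B - C)))"
      using finAB fin_dom[OF C(1)] by (intro card_mono) auto
    also have "\<dots> \<le> 2"
      using card_Un_le[of "(A - C) \<union> (C - A)" "(C - B) \<union> (B - C)"] C by simp
    finally show "card (A - B) = 1"
      using sym_diff halves(3) by linarith
  next
    assume one: "card (A - B) = 1"
    have "dominating_set G (A \<union> B)"
      using dom by (auto intro: dominating_set_superset simp: dominating_set_def)
    moreover have "(A - (A \<union> B)) \<union> ((A \<union> B) - A) = B - A"
      and "((A \<union> B) - B) \<union> (B - (A \<union> B)) = A - B"
      by auto
    ultimately have "(A, A \<union> B) \<in> parcs (dominating_graph G)"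
      and "(A \<union> B, B) \<in> parcs (dominating_graph G)"
      unfolding adj using dom one halves(2) by simp_all
    then show "\<exists>C. (A, C) \<in> parcs (dominating_graph G) \<and> (C, B) \<in> parcs (dominating_graph G)"
      by blast
  qed
  then show ?thesis
    using graph_dist_eq_2_iff[OF pair_wf_digraph_axioms] \<open>A \<noteq> B\<close> nonadj halves(1) by simp
qed

theorem theorem5:
  fixes n i :: nat and A B :: "nat set"
  assumes "n > 0" and "i > 0"
    and "dominating_set (path_graph n) A" and "dominating_set (path_graph n) B"
    and "A \<noteq> B" and "card A = i" and "card B = i"
  shows "graph_dist (dominating_graph (path_graph n)) A B = 2 \<longleftrightarrow> card (A \<inter> B) = i - 1"
  using dominating_graph_dist_eq_2_iff[of "path_graph n" A B] assms
  by (simp add: path_graph_def)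

end
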